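(* Let $P,Q,R\in\mathbb W$ be such that $P=QR$ is a factorization of $P$, and let $k=\deg_L(R)$ denote the order of $R$. Then $\bigwedge^{k}P$ has a linear right factor of the form $L-a$ for some $a\in\mathbb K(q,M)$; that is, $\bigwedge^kP\in\mathbb W\,(L-a)$.
   Context: $\mathbb K$ is a field of characteristic zero and $\mathbb W=\mathbb K(q,M)\langle L\rangle/(LM-qML)$ is the localized $q$-Weyl algebra: Ore polynomials in $L$ over the field $\mathbb K(q,M)$ with $L\,a(q,M)=a(q,qM)\,L$. It is a (left and right) Euclidean domain with respect to $\deg_L$. Exterior powers: let $P\in\mathbb W$ be nonzero, let $\mathcal M=\mathbb W/(\mathbb WP)$ and let $f\in\mathcal M$ be the class of $1$, so that the left annihilator ideal of $f$ is $\mathbb WP$. For a natural number $k$, $\bigwedge^k\mathcal M$ is the $k$-th exterior power of $\mathcal M$ as a finite-dimensional $\mathbb K(q,M)$-vector space, made into a left $\mathbb W$-module by $L(v_1\wedge\dots\wedge v_k)=Lv_1\wedge\dots\wedge Lv_k$. The operator $\bigwedge^kP\in\mathbb W$ is defined to be a generator of the left ideal $\{S\in\mathbb W\mid S(f\wedge Lf\wedge\dots\wedge L^{k-1}f)=0\}$; it is unique up to left multiplication by a nonzero element of $\mathbb K(q,M)$. *)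

theory Defs
  imports "HOL-Computational_Algebra.Computational_Algebra"
    "HOL-Library.Poly_Mapping" "HOL-Library.Set_Algebras"
begin

section \<open>The field of rational functions in q and M, and the q-shift\<close>

text \<open>
  The outer polynomial variable is M, the inner one is q: the type below is the field of
  fractions of K[q][M].
\<close>

type_synonym 'k ratfun = "'k poly poly fract"

text \<open>The substitution sending \<open>a(q, M)\<close> to \<open>a(q, q M)\<close>: the polynomial \<open>[:0, [:0, 1:]:]\<close> is \<open>q M\<close>.\<close>

definition qshift_poly :: "'k::field_char_0 poly poly \<Rightarrow> 'k poly poly" where
  "qshift_poly p = pcompose p [:0, [:0, 1:]:]"

lemma qshift_poly_add: "qshift_poly (p + r) = qshift_poly p + qshift_poly r"
  and qshift_poly_mult: "qshift_poly (p * r) = qshift_poly p * qshift_poly r"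
  and qshift_poly_0: "qshift_poly 0 = 0"
  and qshift_poly_1: "qshift_poly 1 = 1"
  by (simp_all add: qshift_poly_def pcompose_add pcompose_mult pcompose_1)

lemma qshift_poly_eq_0_iff: "qshift_poly p = 0 \<longleftrightarrow> p = 0"
proof
  assume "qshift_poly p = 0"
  then show "p = 0"
    unfolding qshift_poly_def by (rule pcompose_eq_0) simp
qed (simp add: qshift_poly_0)

text \<open>The value does not depend on the chosen fraction, as \<open>qshift_Fract\<close> shows.\<close>

definition qshift :: "'k::field_char_0 ratfun \<Rightarrow> 'k ratfun" where
  "qshift x = (THE y. \<exists>a b. b \<noteq> 0 \<and> x = Fract a b \<and> y = Fract (qshift_poly a) (qshift_poly b))"

lemma qshift_Fract:
  assumes "b \<noteq> 0"
  shows "qshift (Fract a b) = Fract (qshift_poly a) (qshift_poly b)"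
  unfolding qshift_def
proof (rule the_equality)
  fix y assume "\<exists>c d. d \<noteq> 0 \<and> Fract a b = Fract c d \<and> y = Fract (qshift_poly c) (qshift_poly d)"
  then obtain c d where "d \<noteq> 0" "Fract a b = Fract c d" "y = Fract (qshift_poly c) (qshift_poly d)"
    by blast
  with assms show "y = Fract (qshift_poly a) (qshift_poly b)"
    by (simp add: eq_fract qshift_poly_eq_0_iff qshift_poly_mult[symmetric])
qed (use assms in blast)

lemma qshift_add: "qshift (x + y) = qshift x + qshift y"
  by (cases x; cases y)
     (simp add: qshift_Fract qshift_poly_add qshift_poly_mult qshift_poly_eq_0_iff)

lemma qshift_mult: "qshift (x * y) = qshift x * qshift y"
  by (cases x; cases y) (simp add: qshift_Fract qshift_poly_mult)

lemma qshift_0 [simp]: "qshift 0 = 0"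
  by (simp add: Zero_fract_def qshift_Fract qshift_poly_0 qshift_poly_1)

lemma qshift_1 [simp]: "qshift 1 = 1"
  by (simp add: One_fract_def qshift_Fract qshift_poly_1)

lemma qshift_eq_0_iff [simp]: "qshift x = 0 \<longleftrightarrow> x = 0"
  by (cases x)
     (simp add: qshift_Fract Zero_fract_def eq_fract qshift_poly_eq_0_iff)


section \<open>Evaluation of Ore polynomials at semilinear maps\<close>

text \<open>
  For a coefficient polynomial \<open>p\<close>, read as the Ore polynomial \<open>\<Sum>i. p\<^sub>i L\<^sup>i\<close>
  with coefficients on the left, this is \<open>v \<mapsto> \<Sum>i. p\<^sub>i T\<^sup>i v\<close>, where \<open>T\<close> is the action of \<open>L\<close>.
\<close>

definition ore_act :: "('r::field \<Rightarrow> 'v \<Rightarrow> 'v) \<Rightarrow> ('v \<Rightarrow> 'v) \<Rightarrow> 'r poly \<Rightarrow> 'v \<Rightarrow> 'v::ab_group_add"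
  where "ore_act scl T p v = (\<Sum>i\<le>degree p. scl (coeff p i) ((T ^^ i) v))"

definition shift_mult :: "'k::field_char_0 ratfun poly \<Rightarrow> 'k ratfun poly" where
  "shift_mult p = pCons 0 (map_poly qshift p)"

locale semilinear =
  fixes scl :: "'k::field_char_0 ratfun \<Rightarrow> 'v::ab_group_add \<Rightarrow> 'v" and T :: "'v \<Rightarrow> 'v"
  assumes scl: "module scl"
    and T_add: "T (x + y) = T x + T y"
    and T_scl: "T (scl c x) = scl (qshift c) (T x)"
begin

interpretation module scl by (fact scl)

lemma T_0 [simp]: "T 0 = 0"
  using T_add[of 0 0] by simp

lemma T_sum: "T (sum f A) = (\<Sum>x\<in>A. T (f x))"
  by (induction A rule: infinite_finite_induct) (simp_all add: T_add)

lemma ore_act_bound: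
  assumes "degree p \<le> n"
  shows "ore_act scl T p v = (\<Sum>i\<le>n. scl (coeff p i) ((T ^^ i) v))"
  unfolding ore_act_def
  by (rule sum.mono_neutral_left) (use assms in \<open>auto simp: coeff_eq_0\<close>)

lemma ore_act_0 [simp]: "ore_act scl T 0 v = 0"
  by (simp add: ore_act_def)

lemma ore_act_1 [simp]: "ore_act scl T 1 v = v"
  by (simp add: ore_act_def)

lemma ore_act_add_left: "ore_act scl T (p + r) v = ore_act scl T p v + ore_act scl T r v"
proof -
  let ?n = "max (degree p) (degree r)"
  show ?thesis
    using degree_add_le_max[of p r]
    by (simp add: ore_act_bound[of _ ?n] scale_left_distrib sum.distrib)
qed

lemma ore_act_smult: "ore_act scl T (smult c p) v = scl c (ore_act scl T p v)"
  by (simp add: ore_act_bound[of _ "degree p"] degree_smult_le scale_sum_right)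

lemma ore_act_pCons: "ore_act scl T (pCons a p) v = scl a v + ore_act scl T p (T v)"
proof -
  have "ore_act scl T (pCons a p) v = (\<Sum>i\<le>Suc (degree p). scl (coeff (pCons a p) i) ((T ^^ i) v))"
    by (rule ore_act_bound) (simp add: degree_pCons_le)
  also have "\<dots> = scl a v + (\<Sum>i\<le>degree p. scl (coeff p i) ((T ^^ i) (T v)))"
    by (subst sum.atMost_Suc_shift) (simp add: funpow_swap1)
  finally show ?thesis by (simp add: ore_act_def)
qed

lemma pow_add: "(T ^^ i) (x + y) = (T ^^ i) x + (T ^^ i) y"
  by (induction i) (simp_all add: T_add)

lemma ore_act_add_right: "ore_act scl T p (x + y) = ore_act scl T p x + ore_act scl T p y"
  by (simp add: ore_act_def pow_add scale_right_distrib sum.distrib)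

lemma T_ore_act: "T (ore_act scl T p v) = ore_act scl T (shift_mult p) v"
proof -
  have "ore_act scl T (shift_mult p) v = ore_act scl T (map_poly qshift p) (T v)"
    by (simp add: shift_mult_def ore_act_pCons)
  also have "\<dots> = (\<Sum>i\<le>degree p. scl (qshift (coeff p i)) ((T ^^ i) (T v)))"
    by (subst ore_act_bound[of _ "degree p"]) (simp_all add: map_poly_degree_leq coeff_map_poly)
  also have "\<dots> = T (ore_act scl T p v)"
    by (simp add: ore_act_def T_sum T_scl funpow_swap1)
  finally show ?thesis ..
qed

end

interpretation shift_mult: semilinear smult shift_mult
proof
  show "shift_mult (p + r) = shift_mult p + shift_mult r" for p r :: "'a ratfun poly"
    by (auto intro!: poly_eqI simp: shift_mult_def coeff_pCons coeff_map_poly qshift_add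
        split: nat.split)
  show "shift_mult (smult c p) = smult (qshift c) (shift_mult p)" for c and p :: "'a ratfun poly"
    by (auto intro!: poly_eqI simp: shift_mult_def coeff_pCons coeff_map_poly qshift_mult
        split: nat.split)
qed (simp_all add: smult_add_left smult_add_right)

lemma (in semilinear) ore_act_ore_act:
  "ore_act scl T p (ore_act scl T r v) = ore_act scl T (ore_act smult shift_mult p r) v"
proof (induction p arbitrary: r)
  case 0
  show ?case by (simp add: shift_mult.ore_act_0)
next
  case (pCons a p)
  have "ore_act scl T (pCons a p) (ore_act scl T r v) =
      scl a (ore_act scl T r v) + ore_act scl T p (ore_act scl T (shift_mult r) v)"
    by (simp add: ore_act_pCons T_ore_act)
  also have "\<dots> = ore_act scl T (ore_act smult shift_mult (pCons a p) r) v"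
    by (simp add: pCons.IH shift_mult.ore_act_pCons ore_act_add_left ore_act_smult)
  finally show ?case .
qed


section \<open>The localized q-Weyl algebra\<close>

text \<open>
  The coefficient polynomial \<open>\<Sum>i. p\<^sub>i x\<^sup>i\<close> represents the operator \<open>\<Sum>i. p\<^sub>i L\<^sup>i\<close>.
  The product is \<open>(\<Sum>i. p\<^sub>i L\<^sup>i) R = \<Sum>i. p\<^sub>i (L\<^sup>i R)\<close>, where
  \<open>L (\<Sum>j. r\<^sub>j L\<^sup>j) = \<Sum>j. \<sigma>(r\<^sub>j) L\<^sup>j\<^sup>+\<^sup>1\<close> with \<open>\<sigma>\<close> the q-shift.
\<close>

typedef (overloaded) 'k qweyl = "UNIV :: 'k::field_char_0 ratfun poly set"
  morphisms poly_of_qweyl qweyl_of_poly ..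

setup_lifting type_definition_qweyl

instantiation qweyl :: (field_char_0) ring_1
begin

lift_definition zero_qweyl :: "'a qweyl" is 0 .
lift_definition one_qweyl :: "'a qweyl" is 1 .
lift_definition plus_qweyl :: "'a qweyl \<Rightarrow> 'a qweyl \<Rightarrow> 'a qweyl" is "(+)" .
lift_definition minus_qweyl :: "'a qweyl \<Rightarrow> 'a qweyl \<Rightarrow> 'a qweyl" is "(-)" .
lift_definition uminus_qweyl :: "'a qweyl \<Rightarrow> 'a qweyl" is "uminus" .
lift_definition times_qweyl :: "'a qweyl \<Rightarrow> 'a qweyl \<Rightarrow> 'a qweyl" is "ore_act smult shift_mult" .

instance
proof
  fix a b c :: "'a qweyl"
  show "a * b * c = a * (b * c)"
    by transfer (rule shift_mult.ore_act_ore_act[symmetric])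
  show "(a + b) * c = a * c + b * c"
    by transfer (rule shift_mult.ore_act_add_left)
  show "a * (b + c) = a * b + a * c"
    by transfer (rule shift_mult.ore_act_add_right)
  show "1 * a = a"
    by transfer (rule shift_mult.ore_act_1)
  show "a * 1 = a"
  proof transfer
    fix p :: "'a ratfun poly"
    have "(shift_mult ^^ i) 1 = (monom 1 i :: 'a ratfun poly)" for i
      by (induction i) (simp_all add: shift_mult_def monom_Suc map_poly_monom)
    then show "ore_act smult shift_mult p 1 = p"
      by (simp add: ore_act_def smult_monom poly_as_sum_of_monoms)
  qed
  show "(0::'a qweyl) \<noteq> 1"
    by transfer simp
qed (transfer; simp)+

end

lift_definition opL :: "'k::field_char_0 qweyl" is "[:0, 1:] :: 'k ratfun poly" .

lift_definition of_ratfun :: "'k::field_char_0 ratfun \<Rightarrow> 'k qweyl" is "\<lambda>a::'k ratfun. [:a:]" .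

lift_definition deg_L :: "'k::field_char_0 qweyl \<Rightarrow> nat" is "degree :: 'k ratfun poly \<Rightarrow> nat" .

lemma of_ratfun_add: "of_ratfun (a + b) = of_ratfun a + of_ratfun b"
  by transfer simp

lemma of_ratfun_mult: "of_ratfun (a * b) = of_ratfun a * of_ratfun b"
  by transfer (simp add: shift_mult.ore_act_pCons)

lemma of_ratfun_0 [simp]: "of_ratfun 0 = 0"
  by transfer simp

lemma of_ratfun_1 [simp]: "of_ratfun 1 = 1"
  by transfer (simp add: one_pCons)

lemma poly_of_ratfun_times: "poly_of_qweyl (of_ratfun c * P) = smult c (poly_of_qweyl P)"
  by (simp add: times_qweyl.rep_eq of_ratfun.rep_eq shift_mult.ore_act_pCons)

lemma poly_of_opL_times: "poly_of_qweyl (opL * P) = shift_mult (poly_of_qweyl P)"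
  by (simp add: times_qweyl.rep_eq opL.rep_eq shift_mult.ore_act_pCons)

lemma opL_of_ratfun: "opL * of_ratfun a = of_ratfun (qshift a) * opL"
proof -
  have "poly_of_qweyl (opL * of_ratfun a) = poly_of_qweyl (of_ratfun (qshift a) * opL)"
    by (simp add: poly_of_opL_times poly_of_ratfun_times of_ratfun.rep_eq opL.rep_eq
        shift_mult_def map_poly_pCons)
  then show ?thesis by (simp add: poly_of_qweyl_inject)
qed

lemma poly_of_opL_power: "poly_of_qweyl (opL ^ i) = monom 1 i"
  by (induction i)
     (simp_all add: one_qweyl.rep_eq poly_of_opL_times shift_mult_def map_poly_monom monom_Suc)

lemma qweyl_expansion: "P = (\<Sum>i\<le>deg_L P. of_ratfun (coeff (poly_of_qweyl P) i) * opL ^ i)"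
proof -
  have sum_rep: "poly_of_qweyl (sum f A) = (\<Sum>i\<in>A. poly_of_qweyl (f i))"
    for f :: "nat \<Rightarrow> 'a qweyl" and A
    by (induction A rule: infinite_finite_induct) (simp_all add: zero_qweyl.rep_eq plus_qweyl.rep_eq)
  have "poly_of_qweyl P =
      poly_of_qweyl (\<Sum>i\<le>deg_L P. of_ratfun (coeff (poly_of_qweyl P) i) * opL ^ i)"
    by (simp add: sum_rep poly_of_ratfun_times poly_of_opL_power smult_monom deg_L.rep_eq
        poly_as_sum_of_monoms)
  then show ?thesis by (simp add: poly_of_qweyl_inject)
qed


section \<open>The cyclic module W / W P\<close>

definition left_ideal :: "'k::field_char_0 qweyl \<Rightarrow> 'k qweyl set" where
  "left_ideal P = {S * P | S. True}"

definition quot_carrier :: "'k::field_char_0 qweyl \<Rightarrow> 'k qweyl set set" where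
  "quot_carrier P = {A +o left_ideal P | A. True}"

text \<open>
  Cosets are added as sets (Minkowski sum), and \<open>S\<close> maps the coset of \<open>A\<close> to that of \<open>S A\<close>;
  the submodule is added because \<open>S *o X\<close> is in general only part of a coset.
\<close>

definition quot_act :: "'k::field_char_0 qweyl \<Rightarrow> 'k qweyl \<Rightarrow> 'k qweyl set \<Rightarrow> 'k qweyl set" where
  "quot_act P S X = S *o X + left_ideal P"

definition quot_gen :: "'k::field_char_0 qweyl \<Rightarrow> 'k qweyl set" where
  "quot_gen P = 1 +o left_ideal P"


section \<open>Exterior powers\<close>

text \<open>
  The exterior power of a vector space, given by a carrier \<open>V\<close>, an addition and a scalar
  multiplication, is the free vector space on the \<open>k\<close>-tuples of vectors modulo the span of the
  multilinearity and alternation relations.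
\<close>

definition tuples :: "'v set \<Rightarrow> nat \<Rightarrow> 'v list set" where
  "tuples V k = {vs. set vs \<subseteq> V \<and> length vs = k}"

definition pm_scale :: "'r::field \<Rightarrow> ('b \<Rightarrow>\<^sub>0 'r) \<Rightarrow> ('b \<Rightarrow>\<^sub>0 'r)" where
  "pm_scale c = Poly_Mapping.map ((*) c)"

lemma lookup_pm_scale [simp]: "Poly_Mapping.lookup (pm_scale c x) b = c * Poly_Mapping.lookup x b"
  unfolding pm_scale_def by transfer (simp add: when_def)

interpretation pm: vector_space pm_scale
  by standard (auto intro!: poly_mapping_eqI simp: lookup_add algebra_simps)

definition wedge_relators ::
    "'v set \<Rightarrow> ('v \<Rightarrow> 'v \<Rightarrow> 'v) \<Rightarrow> ('r::field \<Rightarrow> 'v \<Rightarrow> 'v) \<Rightarrow> nat \<Rightarrow> ('v list \<Rightarrow>\<^sub>0 'r) set" where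
  "wedge_relators V add scl k =
     {Poly_Mapping.single (vs[i := add x y]) 1 - Poly_Mapping.single (vs[i := x]) 1
        - Poly_Mapping.single (vs[i := y]) 1
      | vs i x y. vs \<in> tuples V k \<and> i < k \<and> x \<in> V \<and> y \<in> V} \<union>
     {Poly_Mapping.single (vs[i := scl c x]) 1 - pm_scale c (Poly_Mapping.single (vs[i := x]) 1)
      | vs i c x. vs \<in> tuples V k \<and> i < k \<and> x \<in> V} \<union>
     {Poly_Mapping.single vs 1 | vs i j. vs \<in> tuples V k \<and> i < j \<and> j < k \<and> vs ! i = vs ! j}"

text \<open>The span of the relations for the exterior power \<open>\<And>\<^sup>k (W / W P)\<close> over the field of rational functions.\<close>

definition ext_null :: "'k::field_char_0 qweyl \<Rightarrow> nat \<Rightarrow> ('k qweyl set list \<Rightarrow>\<^sub>0 'k ratfun) set" where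
  "ext_null P k =
     pm.span (wedge_relators (quot_carrier P) (+) (\<lambda>c. quot_act P (of_ratfun c)) k)"

definition ext_carrier ::
    "'k::field_char_0 qweyl \<Rightarrow> nat \<Rightarrow> ('k qweyl set list \<Rightarrow>\<^sub>0 'k ratfun) set set" where
  "ext_carrier P k = {x +o ext_null P k | x. Poly_Mapping.keys x \<subseteq> tuples (quot_carrier P) k}"

definition wedge ::
    "'k::field_char_0 qweyl \<Rightarrow> 'k qweyl set list \<Rightarrow> ('k qweyl set list \<Rightarrow>\<^sub>0 'k ratfun) set" where
  "wedge P vs = Poly_Mapping.single vs 1 +o ext_null P (length vs)"

text \<open>
  On the free vector space, \<open>L\<close> sends \<open>c [v\<^sub>1, \<dots>, v\<^sub>k]\<close> to \<open>\<sigma>(c) [L v\<^sub>1, \<dots>, L v\<^sub>k]\<close>.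
  This extends to the algebra and passes to the quotient.
\<close>

definition free_L :: "'k::field_char_0 qweyl \<Rightarrow>
    ('k qweyl set list \<Rightarrow>\<^sub>0 'k ratfun) \<Rightarrow> ('k qweyl set list \<Rightarrow>\<^sub>0 'k ratfun)" where
  "free_L P x = (\<Sum>vs\<in>Poly_Mapping.keys x.
     Poly_Mapping.single (map (quot_act P opL) vs) (qshift (Poly_Mapping.lookup x vs)))"

definition free_act :: "'k::field_char_0 qweyl \<Rightarrow> 'k qweyl \<Rightarrow>
    ('k qweyl set list \<Rightarrow>\<^sub>0 'k ratfun) \<Rightarrow> ('k qweyl set list \<Rightarrow>\<^sub>0 'k ratfun)" where
  "free_act P S = ore_act pm_scale (free_L P) (poly_of_qweyl S)"

definition ext_act :: "'k::field_char_0 qweyl \<Rightarrow> nat \<Rightarrow> 'k qweyl \<Rightarrow>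
    ('k qweyl set list \<Rightarrow>\<^sub>0 'k ratfun) set \<Rightarrow> ('k qweyl set list \<Rightarrow>\<^sub>0 'k ratfun) set" where
  "ext_act P k S X = free_act P S ` X + ext_null P k"

text \<open>The annihilator of \<open>f \<and> L f \<and> \<dots> \<and> L\<^sup>k\<^sup>-\<^sup>1 f\<close>, where \<open>f\<close> is the class of 1.\<close>

definition ext_ann :: "'k::field_char_0 qweyl \<Rightarrow> nat \<Rightarrow> 'k qweyl set" where
  "ext_ann P k = {S. ext_act P k S
     (wedge P (map (\<lambda>i. quot_act P (opL ^ i) (quot_gen P)) [0..<k])) = ext_null P k}"

text \<open>
  The \<open>k\<close>-th exterior power of \<open>P\<close> is only determined up to a unit, so it is given as a
  predicate: \<open>E\<close> generates the annihilator.
\<close>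

definition is_exterior_power :: "nat \<Rightarrow> 'k::field_char_0 qweyl \<Rightarrow> 'k qweyl \<Rightarrow> bool" where
  "is_exterior_power k P E \<longleftrightarrow> ext_ann P k = left_ideal E"


section \<open>Well-definedness\<close>

subsection \<open>Cosets\<close>

lemma coset_eq_iff:
  fixes N :: "'b::ab_group_add set"
  assumes "0 \<in> N" "\<And>x y. x \<in> N \<Longrightarrow> y \<in> N \<Longrightarrow> x - y \<in> N"
  shows "x +o N = y +o N \<longleftrightarrow> x - y \<in> N"
proof
  assume "x +o N = y +o N"
  moreover have "x \<in> x +o N"
    using assms(1) by (force simp: elt_set_plus_def)
  ultimately show "x - y \<in> N"
    by (auto simp: elt_set_plus_def)
next
  have neg: "- u \<in> N" if "u \<in> N" for u
    using assms(2)[OF assms(1) that] by simp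
  have sub: "x +o N \<subseteq> y +o N" if "x - y \<in> N" for x y
  proof
    fix z assume "z \<in> x +o N"
    then obtain n where n: "n \<in> N" "z = x + n" by (auto simp: elt_set_plus_def)
    have "(x - y) - (- n) \<in> N" by (rule assms(2)[OF that neg[OF n(1)]])
    moreover have "z = y + ((x - y) - (- n))" using n by simp
    ultimately show "z \<in> y +o N" unfolding elt_set_plus_def by blast
  qed
  assume d: "x - y \<in> N"
  with neg[OF d] show "x +o N = y +o N"
    using sub[of x y] sub[of y x] by simp
qed

lemma coset_add:
  fixes N :: "'b::ab_group_add set"
  assumes "0 \<in> N" "\<And>x y. x \<in> N \<Longrightarrow> y \<in> N \<Longrightarrow> x + y \<in> N"
  shows "(x +o N) + (y +o N) = (x + y) +o N"
proof -
  have "N + N = N"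
    using assms by (force simp: set_plus_def)
  then show ?thesis by (simp add: set_plus_rearrange)
qed

lemma coset_image:
  fixes N :: "'b::ab_group_add set"
  assumes "0 \<in> N" "\<And>x y. x \<in> N \<Longrightarrow> y \<in> N \<Longrightarrow> x + y \<in> N"
    and "\<And>x y. f (x + y) = f x + f y" "\<And>x. x \<in> N \<Longrightarrow> f x \<in> N"
  shows "f ` (x +o N) + N = f x +o N"
proof
  show "f ` (x +o N) + N \<subseteq> f x +o N"
    using assms by (auto simp: elt_set_plus_def set_plus_def add.assoc)
  show "f x +o N \<subseteq> f ` (x +o N) + N"
  proof
    fix z assume "z \<in> f x +o N"
    moreover have "f x \<in> f ` (x +o N)"
      using assms(1) by (force simp: elt_set_plus_def)
    ultimately show "z \<in> f ` (x +o N) + N"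
      by (auto simp: elt_set_plus_def set_plus_def)
  qed
qed


subsection \<open>The cyclic module\<close>

lemma left_ideal_0: "0 \<in> left_ideal P"
  by (auto simp: left_ideal_def intro!: exI[of _ 0])

lemma left_ideal_add: "A \<in> left_ideal P \<Longrightarrow> B \<in> left_ideal P \<Longrightarrow> A + B \<in> left_ideal P"
  unfolding left_ideal_def using distrib_right[of _ _ P] by (smt (verit) mem_Collect_eq)

lemma left_ideal_mult: "A \<in> left_ideal P \<Longrightarrow> S * A \<in> left_ideal P"
  unfolding left_ideal_def by (auto simp: mult.assoc[symmetric])

lemma left_ideal_diff: "A \<in> left_ideal P \<Longrightarrow> B \<in> left_ideal P \<Longrightarrow> A - B \<in> left_ideal P"
  using left_ideal_add[of A P "(-1) * B"] left_ideal_mult[of B P "-1"] by simp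

lemma quot_coset_eq_iff: "A +o left_ideal P = B +o left_ideal P \<longleftrightarrow> A - B \<in> left_ideal P"
  by (intro coset_eq_iff left_ideal_0 left_ideal_diff)

lemma quot_add_coset:
  "(A +o left_ideal P) + (B +o left_ideal P) = (A + B) +o left_ideal P"
  by (intro coset_add left_ideal_0 left_ideal_add)

lemma quot_act_coset: "quot_act P S (A +o left_ideal P) = (S * A) +o left_ideal P"
proof -
  have "quot_act P S (A +o left_ideal P) = (*) S ` (A +o left_ideal P) + left_ideal P"
    unfolding quot_act_def elt_set_times_def by (rule arg_cong[of _ _ "\<lambda>X. X + _"]) auto
  also have "\<dots> = (S * A) +o left_ideal P"
    by (intro coset_image left_ideal_0 left_ideal_add left_ideal_mult distrib_left)
  finally show ?thesis .
qed

lemma quot_carrierE: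
  assumes "X \<in> quot_carrier P"
  obtains A where "X = A +o left_ideal P"
  using assms by (auto simp: quot_carrier_def)

lemma coset_in_quot_carrier [intro]: "A +o left_ideal P \<in> quot_carrier P"
  by (auto simp: quot_carrier_def)

lemma quot_add_closed: "X \<in> quot_carrier P \<Longrightarrow> Y \<in> quot_carrier P \<Longrightarrow> X + Y \<in> quot_carrier P"
  by (elim quot_carrierE) (auto simp: quot_add_coset)

lemma quot_act_closed: "X \<in> quot_carrier P \<Longrightarrow> quot_act P S X \<in> quot_carrier P"
  by (elim quot_carrierE) (auto simp: quot_act_coset)

lemma quot_act_add:
  "X \<in> quot_carrier P \<Longrightarrow> Y \<in> quot_carrier P \<Longrightarrow>
    quot_act P S (X + Y) = quot_act P S X + quot_act P S Y"
  by (elim quot_carrierE) (auto simp: quot_act_coset quot_add_coset distrib_left)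

lemma quot_act_mult:
  "X \<in> quot_carrier P \<Longrightarrow> quot_act P S (quot_act P T X) = quot_act P (S * T) X"
  by (elim quot_carrierE) (auto simp: quot_act_coset mult.assoc)

lemma quot_gen_annihilator: "{S. quot_act P S (quot_gen P) = left_ideal P} = left_ideal P"
  using quot_coset_eq_iff[of _ P 0] by (auto simp: quot_gen_def quot_act_coset)


subsection \<open>The exterior power as a module over the q-Weyl algebra\<close>

lemma free_L_superset:
  assumes "finite A" "Poly_Mapping.keys x \<subseteq> A"
  shows "free_L P x = (\<Sum>vs\<in>A.
     Poly_Mapping.single (map (quot_act P opL) vs) (qshift (Poly_Mapping.lookup x vs)))"
  unfolding free_L_def
  by (rule sum.mono_neutral_left) (use assms in \<open>auto simp: in_keys_iff\<close>)

lemma free_L_add: "free_L P (x + y) = free_L P x + free_L P y"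
proof -
  let ?A = "Poly_Mapping.keys x \<union> Poly_Mapping.keys y"
  show ?thesis
    using keys_add[of x y]
    by (simp add: free_L_superset[of ?A] lookup_add qshift_add single_add sum.distrib)
qed

lemma pm_scale_single [simp]: "pm_scale c (Poly_Mapping.single b d) = Poly_Mapping.single b (c * d)"
  by (rule poly_mapping_eqI) (simp add: lookup_single when_def)

lemma free_L_scale: "free_L P (pm_scale c x) = pm_scale (qshift c) (free_L P x)"
proof -
  have "Poly_Mapping.keys (pm_scale c x) \<subseteq> Poly_Mapping.keys x"
    by (auto simp: in_keys_iff)
  then show ?thesis
    by (simp add: free_L_superset[of "Poly_Mapping.keys x"] qshift_mult pm.scale_sum_right)
qed

interpretation free: semilinear pm_scale "free_L P" for P
  by standard (simp_all add: free_L_add free_L_scale pm.scale_right_distrib pm.scale_left_distrib)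

lemma free_L_single:
  "free_L P (Poly_Mapping.single vs c) = Poly_Mapping.single (map (quot_act P opL) vs) (qshift c)"
  by (simp add: free_L_superset[of "{vs}"])

lemma free_L_minus: "free_L P (- x) = - free_L P x"
  using free_L_add[of P x "- x"] by (simp add: eq_neg_iff_add_eq_0 add.commute)

lemma free_L_diff: "free_L P (x - y) = free_L P x - free_L P y"
  using free_L_add[of P x "- y"] by (simp add: free_L_minus)

lemma map_tuples: "vs \<in> tuples (quot_carrier P) k \<Longrightarrow> map (quot_act P S) vs \<in> tuples (quot_carrier P) k"
  by (auto simp: tuples_def quot_act_closed)

lemma free_L_relators:
  assumes "r \<in> wedge_relators (quot_carrier P) (+) (\<lambda>c. quot_act P (of_ratfun c)) k"
  shows "free_L P r \<in> wedge_relators (quot_carrier P) (+) (\<lambda>c. quot_act P (of_ratfun c)) k"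
proof -
  let ?l = "quot_act P opL" and ?s = "\<lambda>vs. Poly_Mapping.single vs (1 :: 'a ratfun)"
  from assms consider
      (add) vs i x y where "vs \<in> tuples (quot_carrier P) k" "i < k"
        "x \<in> quot_carrier P" "y \<in> quot_carrier P"
        "r = ?s (vs[i := x + y]) - ?s (vs[i := x]) - ?s (vs[i := y])"
    | (scale) vs i c x where "vs \<in> tuples (quot_carrier P) k" "i < k" "x \<in> quot_carrier P"
        "r = ?s (vs[i := quot_act P (of_ratfun c) x]) - pm_scale c (?s (vs[i := x]))"
    | (alt) vs i j where "vs \<in> tuples (quot_carrier P) k" "i < j" "j < k" "vs ! i = vs ! j"
        "r = ?s vs"
    unfolding wedge_relators_def by blast
  then show ?thesis
  proof cases
    case add
    have "free_L P r = ?s ((map ?l vs)[i := ?l x + ?l y]) - ?s ((map ?l vs)[i := ?l x])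
        - ?s ((map ?l vs)[i := ?l y])"
      using add by (simp add: free_L_diff free_L_single map_update quot_act_add)
    then show ?thesis
      unfolding wedge_relators_def
      using add quot_act_closed[of _ P opL] map_tuples[of vs P k opL] by blast
  next
    case scale
    have "?l (quot_act P (of_ratfun c) x) = quot_act P (of_ratfun (qshift c)) (?l x)"
      using scale by (simp add: quot_act_mult opL_of_ratfun)
    then have "free_L P r = ?s ((map ?l vs)[i := quot_act P (of_ratfun (qshift c)) (?l x)])
        - pm_scale (qshift c) (?s ((map ?l vs)[i := ?l x]))"
      using scale by (simp add: free_L_diff free_L_single map_update)
    then show ?thesis
      unfolding wedge_relators_def
      using scale quot_act_closed[of _ P opL] map_tuples[of vs P k opL] by blast
  next
    case alt
    then have "free_L P r = ?s (map ?l vs)" "map ?l vs ! i = map ?l vs ! j"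
      by (auto simp: free_L_single tuples_def)
    then show ?thesis
      unfolding wedge_relators_def using alt map_tuples[of vs P k opL] by blast
  qed
qed

lemma ext_null_subspace: "pm.subspace (ext_null P k)"
  by (simp add: ext_null_def pm.subspace_span)

lemmas ext_null_0 = pm.subspace_0[OF ext_null_subspace]
  and ext_null_add = pm.subspace_add[OF ext_null_subspace]
  and ext_null_diff = pm.subspace_diff[OF ext_null_subspace]
  and ext_null_scale = pm.subspace_scale[OF ext_null_subspace]
  and ext_null_sum = pm.subspace_sum[OF ext_null_subspace]

lemma free_L_ext_null:
  assumes "x \<in> ext_null P k"
  shows "free_L P x \<in> ext_null P k"
  using assms unfolding ext_null_def
proof (induction rule: pm.span_induct_alt)
  case base
  show ?case by (simp add: pm.span_zero)
next
  case (step c x y)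
  then show ?case
    by (simp add: free_L_add free_L_scale pm.span_add pm.span_scale pm.span_base free_L_relators)
qed

lemma free_act_ext_null:
  assumes "x \<in> ext_null P k"
  shows "free_act P S x \<in> ext_null P k"
proof -
  have "(free_L P ^^ i) x \<in> ext_null P k" for i
    by (induction i) (simp_all add: assms free_L_ext_null)
  then show ?thesis
    unfolding free_act_def ore_act_def by (intro ext_null_sum ext_null_scale)
qed

lemma ext_coset_eq_iff: "x +o ext_null P k = y +o ext_null P k \<longleftrightarrow> x - y \<in> ext_null P k"
  by (intro coset_eq_iff ext_null_0 ext_null_diff)

lemma ext_coset_eq_null_iff: "x +o ext_null P k = ext_null P k \<longleftrightarrow> x \<in> ext_null P k"
  using ext_coset_eq_iff[of x P k 0] by simp

lemma ext_add_coset: "(x +o ext_null P k) + (y +o ext_null P k) = (x + y) +o ext_null P k"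
  by (intro coset_add ext_null_0 ext_null_add)

lemma ext_act_coset: "ext_act P k S (x +o ext_null P k) = free_act P S x +o ext_null P k"
  unfolding ext_act_def
  by (intro coset_image ext_null_0 ext_null_add free_act_ext_null)
     (simp_all add: free_act_def free.ore_act_add_right)

lemma free_act_mult: "free_act P (S * T) x = free_act P S (free_act P T x)"
  by (simp add: free_act_def times_qweyl.rep_eq free.ore_act_ore_act)

lemma free_act_add: "free_act P (S + T) x = free_act P S x + free_act P T x"
  by (simp add: free_act_def plus_qweyl.rep_eq free.ore_act_add_left)

lemma free_act_1: "free_act P 1 x = x"
  by (simp add: free_act_def one_qweyl.rep_eq)

lemma free_act_of_ratfun: "free_act P (of_ratfun c) x = pm_scale c x"
  by (simp add: free_act_def of_ratfun.rep_eq free.ore_act_pCons)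

lemma free_act_opL: "free_act P opL x = free_L P x"
  by (simp add: free_act_def opL.rep_eq free.ore_act_pCons)

lemma ext_act_mult:
  "X \<in> ext_carrier P k \<Longrightarrow> ext_act P k S (ext_act P k T X) = ext_act P k (S * T) X"
  by (auto simp: ext_carrier_def ext_act_coset free_act_mult)

lemma ext_act_opL_wedge:
  "ext_act P (length vs) opL (wedge P vs) = wedge P (map (quot_act P opL) vs)"
  by (simp add: wedge_def ext_act_coset free_act_opL free_L_single)

lemma ext_act_closed:
  assumes "X \<in> ext_carrier P k"
  shows "ext_act P k S X \<in> ext_carrier P k"
proof -
  let ?T = "tuples (quot_carrier P) k"
  from assms obtain x where x: "X = x +o ext_null P k" "Poly_Mapping.keys x \<subseteq> ?T"
    by (auto simp: ext_carrier_def)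
  have sum_keys: "Poly_Mapping.keys (sum f A) \<subseteq> ?T"
    if "\<And>a. a \<in> A \<Longrightarrow> Poly_Mapping.keys (f a) \<subseteq> ?T"
    for f :: "'b \<Rightarrow> 'a qweyl set list \<Rightarrow>\<^sub>0 'a ratfun" and A
    using that
    by (induction A rule: infinite_finite_induct) (auto dest!: subsetD[OF keys_add])
  have "Poly_Mapping.keys ((free_L P ^^ i) x) \<subseteq> ?T" for i
  proof (induction i)
    case (Suc i)
    then show ?case
      by (auto simp: free_L_def intro!: sum_keys map_tuples split: if_splits)
  qed (use x in simp)
  then have "Poly_Mapping.keys (pm_scale c ((free_L P ^^ i) x)) \<subseteq> ?T" for c i
    by (force simp: in_keys_iff)
  then have "Poly_Mapping.keys (free_act P S x) \<subseteq> ?T"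
    unfolding free_act_def ore_act_def by (intro sum_keys)
  then show ?thesis
    unfolding ext_carrier_def x(1) ext_act_coset by blast
qed

lemma ext_ann_iff:
  "S \<in> ext_ann P k \<longleftrightarrow>
   free_act P S (Poly_Mapping.single (map (\<lambda>i. quot_act P (opL ^ i) (quot_gen P)) [0..<k]) 1)
     \<in> ext_null P k"
  using ext_act_coset[of P k S] by (simp add: ext_ann_def wedge_def ext_coset_eq_null_iff)


subsection \<open>Existence of exterior powers of operators\<close>

lemma deg_opL_power_times:
  assumes "A \<noteq> 0"
  shows "opL ^ m * A \<noteq> 0 \<and> deg_L (opL ^ m * A) = deg_L A + m"
proof (induction m)
  case (Suc m)
  let ?p = "poly_of_qweyl (opL ^ m * A)"
  have "?p \<noteq> 0"
    using Suc by (metis poly_of_qweyl_inject zero_qweyl.rep_eq)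
  then have "map_poly qshift ?p \<noteq> 0" "degree (map_poly qshift ?p) = degree ?p"
    by (auto simp: map_poly_eq_0_iff intro!: degree_map_poly)
  then have "shift_mult ?p \<noteq> 0 \<and> degree (shift_mult ?p) = Suc (degree ?p)"
    by (simp add: shift_mult_def)
  then show ?case
    using Suc by (simp add: mult.assoc poly_of_opL_times[symmetric] deg_L.rep_eq)
      (metis zero_qweyl.rep_eq)
qed (use assms in simp)

lemma left_ideal_principal:
  fixes I :: "'k::field_char_0 qweyl set"
  assumes "0 \<in> I" "\<And>A B. A \<in> I \<Longrightarrow> B \<in> I \<Longrightarrow> A + B \<in> I" "\<And>S A. A \<in> I \<Longrightarrow> S * A \<in> I"
  shows "\<exists>E. I = left_ideal E"
proof (cases "I \<subseteq> {0}")
  case True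
  then show ?thesis
    using assms(1) by (intro exI[of _ 0]) (auto simp: left_ideal_def)
next
  case False
  define E where "E = arg_min deg_L (\<lambda>A. A \<in> I \<and> A \<noteq> 0)"
  from False obtain A0 where A0: "A0 \<in> I \<and> A0 \<noteq> 0" by blast
  have E: "E \<in> I" "E \<noteq> 0"
    using arg_min_natI[of "\<lambda>A. A \<in> I \<and> A \<noteq> 0", OF A0] unfolding E_def by blast+
  have E_le: "deg_L E \<le> deg_L A" if "A \<in> I" "A \<noteq> 0" for A
    unfolding E_def by (rule arg_min_nat_le) (use that in blast)
  have "A \<in> left_ideal E" if "A \<in> I" for A
    using that
  proof (induction "deg_L A" arbitrary: A rule: less_induct)
    case less
    show ?case
    proof (cases "A = 0")
      case True
      then show ?thesis by (simp add: left_ideal_0)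
    next
      case False
      define B where "B = opL ^ (deg_L A - deg_L E) * E"
      have B: "B \<noteq> 0" "deg_L B = deg_L A" "B \<in> I" "B \<in> left_ideal E"
        using deg_opL_power_times[OF E(2)] E_le[OF less.prems False] E(1)
        by (auto simp: B_def left_ideal_def assms(3))
      let ?p = "poly_of_qweyl A" and ?r = "poly_of_qweyl B"
      define c where "c = lead_coeff ?p / lead_coeff ?r"
      have nz: "?p \<noteq> 0" "?r \<noteq> 0" and deg: "degree ?r = degree ?p"
        using B False by (auto simp: poly_of_qweyl_inject[symmetric] zero_qweyl.rep_eq deg_L.rep_eq)
      define C where "C = A - of_ratfun c * B"
      have pC: "poly_of_qweyl C = ?p - smult c ?r"
        by (simp add: C_def minus_qweyl.rep_eq poly_of_ratfun_times)
      have C_I: "C \<in> I"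
        using assms(2)[OF less.prems assms(3)[OF B(3), of "- of_ratfun c"]] by (simp add: C_def)
      have "C \<in> left_ideal E"
      proof (cases "C = 0")
        case True
        then show ?thesis by (simp add: left_ideal_0)
      next
        case False
        have "degree (poly_of_qweyl C) \<le> degree ?p"
          unfolding pC using deg degree_smult_le[of c ?r] by (intro degree_diff_le) auto
        moreover have "coeff (poly_of_qweyl C) (degree ?p) = 0"
          using nz deg leading_coeff_neq_0[OF nz(2)] by (simp add: pC c_def)
        moreover have "poly_of_qweyl C \<noteq> 0"
          using False by (simp add: poly_of_qweyl_inject[symmetric] zero_qweyl.rep_eq)
        ultimately have "degree (poly_of_qweyl C) < degree ?p"
          by (metis le_neq_implies_less leading_coeff_0_iff)
        then show ?thesis
          using less.hyps[OF _ C_I] by (simp add: deg_L.rep_eq)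
      qed
      then have "C + of_ratfun c * B \<in> left_ideal E"
        by (intro left_ideal_add left_ideal_mult B(4))
      then show ?thesis by (simp add: C_def)
    qed
  qed
  moreover have "left_ideal E \<subseteq> I"
    using assms(3)[OF E(1)] by (auto simp: left_ideal_def)
  ultimately show ?thesis by blast
qed

lemma is_exterior_power_exists: "\<exists>E. is_exterior_power k P E"
  unfolding is_exterior_power_def
proof (rule left_ideal_principal)
  show "0 \<in> ext_ann P k"
    by (simp add: ext_ann_iff free_act_def zero_qweyl.rep_eq ext_null_0)
  show "A + B \<in> ext_ann P k" if "A \<in> ext_ann P k" "B \<in> ext_ann P k" for A B
    using that by (simp add: ext_ann_iff free_act_add ext_null_add)
  show "S * A \<in> ext_ann P k" if "A \<in> ext_ann P k" for S A
    using that by (simp add: ext_ann_iff free_act_mult free_act_ext_null)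
qed

end

theory Submission
  imports "Jordan_Normal_Form.Determinant" Defs
begin

text \<open>
  Since \<open>W P \<subseteq> W R\<close>, the module \<open>W / W P\<close> projects onto \<open>W / W R\<close>, which has dimension
  \<open>k = deg R\<close>, so that \<open>\<And>\<^sup>k (W / W R)\<close> is a line. The projection sends \<open>f \<and> L f \<and> \<dots> \<and> L\<^sup>k\<^sup>-\<^sup>1 f\<close>
  to a basis vector \<open>w\<close> of this line, and \<open>L w = a w\<close> with \<open>a\<close> the determinant of the companion
  matrix of \<open>R\<close>. Every operator that annihilates \<open>f \<and> L f \<and> \<dots> \<and> L\<^sup>k\<^sup>-\<^sup>1 f\<close> also annihilates \<open>w\<close>,
  and the annihilator of \<open>w\<close> is \<open>W (L - a)\<close>.
\<close>

section \<open>Modules of rank one\<close>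

text \<open>The scalar \<open>y\<close> stands for the vector \<open>y w\<close> of a line with
  \<open>L w = a w\<close>.\<close>

interpretation rank_one: semilinear "(*)" "\<lambda>y. a * qshift y"
  for a :: "'k::field_char_0 ratfun"
proof
qed (simp_all add: qshift_add qshift_mult algebra_simps)

lemma qweyl_of_poly_pCons:
  "qweyl_of_poly (pCons c p) = of_ratfun c + qweyl_of_poly p * (opL :: 'k::field_char_0 qweyl)"
proof -
  \<comment> \<open>Multiplying by 1 turns an operator into a value of \<open>ore_act\<close>, to
    which \<open>ore_act_pCons\<close> applies.\<close>
  have "poly_of_qweyl (qweyl_of_poly (pCons c p) * 1)
      = poly_of_qweyl (of_ratfun c * 1 + qweyl_of_poly p * (opL * 1))"
    by (simp only: plus_qweyl.rep_eq poly_of_ratfun_times times_qweyl.rep_eq[of "qweyl_of_poly _"]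
        qweyl_of_poly_inverse[OF UNIV_I] poly_of_opL_times shift_mult.ore_act_pCons)
  then show ?thesis by (simp add: poly_of_qweyl_inject)
qed

text \<open>Right division by \<open>L - a\<close>, from
  \<open>L c = \<sigma>(c) (L - a) + a \<sigma>(c)\<close>: the remainder is the value in the
  rank-one module. The scalar \<open>c\<close> varies because each step replaces it by
  \<open>a \<sigma>(c)\<close>.\<close>

lemma rank_one_remainder:
  "qweyl_of_poly p * of_ratfun c - of_ratfun (ore_act (*) (\<lambda>y. a * qshift y) p c)
     \<in> left_ideal (opL - of_ratfun a)"
proof (induction p arbitrary: c)
  case 0
  then show ?case
    by (simp add: left_ideal_0 zero_qweyl.abs_eq[symmetric])
next
  case (pCons b p)
  let ?q = "qweyl_of_poly p" and ?d = "qshift c"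
  have "of_ratfun b * of_ratfun c = of_ratfun (b * c)"
    "of_ratfun ?d * of_ratfun a = of_ratfun (a * ?d)"
    by (simp_all add: of_ratfun_mult[symmetric] mult.commute)
  then have "qweyl_of_poly (pCons b p) * of_ratfun c
        - of_ratfun (ore_act (*) (\<lambda>y. a * qshift y) (pCons b p) c)
      = (?q * of_ratfun ?d) * (opL - of_ratfun a)
        + (?q * of_ratfun (a * ?d) - of_ratfun (ore_act (*) (\<lambda>y. a * qshift y) p (a * ?d)))"
    by (simp add: qweyl_of_poly_pCons rank_one.ore_act_pCons of_ratfun_add opL_of_ratfun
        algebra_simps)
  also have "\<dots> \<in> left_ideal (opL - of_ratfun a)"
    by (intro left_ideal_add pCons.IH) (auto simp: left_ideal_def)
  finally show ?case .
qed


section \<open>The companion module of an operator\<close>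

text \<open>Clearing the single coefficient at \<open>degree r\<close> is, for nonzero
  \<open>r\<close>, full reduction modulo \<open>r\<close> in degrees up to \<open>degree r\<close>;
  multiplying a reduced polynomial by \<open>L\<close> leads no higher.\<close>

definition lower :: "'k::field_char_0 ratfun poly \<Rightarrow> 'k ratfun poly \<Rightarrow> 'k ratfun poly" where
  "lower r p = p - Polynomial.smult (coeff p (degree r) / lead_coeff r) r"

definition companion_L :: "'k::field_char_0 ratfun poly \<Rightarrow> 'k ratfun poly \<Rightarrow> 'k ratfun poly" where
  "companion_L r p = lower r (shift_mult p)"

lemma lower_add: "lower r (p + s) = lower r p + lower r s"
  by (simp add: lower_def smult_add_left add_divide_distrib)

lemma lower_smult: "lower r (Polynomial.smult c p) = Polynomial.smult c (lower r p)"
  by (simp add: lower_def smult_diff_right)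

lemma lower_sum: "lower r (sum f A) = (\<Sum>x\<in>A. lower r (f x))"
  by (induction A rule: infinite_finite_induct) (simp_all add: lower_add, simp_all add: lower_def)

lemma lower_self: "lower r r = 0"
  by (simp add: lower_def)

lemma lower_monom: "i < degree r \<Longrightarrow> lower r (monom 1 i) = monom 1 i"
  by (simp add: lower_def)

interpretation companion: semilinear Polynomial.smult "companion_L r"
  for r :: "'k::field_char_0 ratfun poly"
proof
qed (simp_all add: companion_L_def lower_add lower_smult shift_mult.T_add shift_mult.T_scl
    smult_add_left smult_add_right)

text \<open>
  The residue of \<open>p\<close> modulo \<open>W r\<close> is \<open>p \<cdot> 1\<close> in the companion module. The class of
  1 is written \<open>lower r 1\<close> because it is 0, not 1, when \<open>r\<close> is a nonzero constant.
\<close>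

definition residue :: "'k::field_char_0 ratfun poly \<Rightarrow> 'k ratfun poly \<Rightarrow> 'k ratfun poly" where
  "residue r p = ore_act Polynomial.smult (companion_L r) p (lower r 1)"

lemma residue_add: "residue r (p + s) = residue r p + residue r s"
  by (simp add: residue_def companion.ore_act_add_left)

lemma residue_smult: "residue r (Polynomial.smult c p) = Polynomial.smult c (residue r p)"
  by (simp add: residue_def companion.ore_act_smult)

lemma residue_shift_mult: "residue r (shift_mult p) = companion_L r (residue r p)"
  by (simp add: residue_def companion.T_ore_act)

lemma residue_times:
  "residue r (ore_act Polynomial.smult shift_mult p s)
     = ore_act Polynomial.smult (companion_L r) p (residue r s)"
  by (simp add: residue_def companion.ore_act_ore_act)

text \<open>Nothing is reduced below \<open>i = degree r\<close>; the endpoint is included for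
  \<open>residue_self\<close>.\<close>

lemma companion_L_power:
  "i \<le> degree r \<Longrightarrow> (companion_L r ^^ i) (lower r 1) = lower r (monom 1 i)"
  by (induction i)
    (simp_all add: companion_L_def lower_monom shift_mult_def map_poly_monom monom_Suc)

lemma residue_monom: "i < degree r \<Longrightarrow> residue r (monom 1 i) = monom 1 i"
  by (simp add: residue_def companion.ore_act_bound[of _ i] degree_monom_eq companion_L_power
      lower_monom if_distrib[of "\<lambda>c. Polynomial.smult c _"] cong: if_cong)

text \<open>By linearity the sum collapses to \<open>lower r r\<close>, so \<open>r\<close> kills
  the class of 1.\<close>

lemma residue_self: "residue r r = 0"
proof -
  have "residue r r = (\<Sum>i\<le>degree r. Polynomial.smult (coeff r i) (lower r (monom 1 i)))"
    unfolding residue_def ore_act_def by (intro sum.cong) (simp_all add: companion_L_power)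
  also have "\<dots> = lower r (\<Sum>i\<le>degree r. monom (coeff r i) i)"
    by (simp add: lower_sum lower_smult[symmetric] smult_monom)
  also have "\<dots> = 0"
    by (simp add: poly_as_sum_of_monoms lower_self)
  finally show ?thesis .
qed

text \<open>Row \<open>j\<close> holds the coordinates of \<open>companion_L r (monom 1 j)\<close>,
  as vectors are rows in \<open>coeff_mat\<close> too. The last row encodes the relation given by
  \<open>r\<close>, made monic.\<close>

definition companion_mat :: "'k::field_char_0 ratfun poly \<Rightarrow> 'k ratfun mat" where
  "companion_mat r = mat (degree r) (degree r)
     (\<lambda>(j, i). (if i = Suc j then 1 else 0)
        - (if Suc j = degree r then coeff r i / lead_coeff r else 0))"

lemma coeff_companion_L:
  assumes "i < degree r"
  shows "coeff (companion_L r p) i = (\<Sum>j<degree r. qshift (coeff p j) * companion_mat r $$ (j, i))"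
proof -
  let ?k = "degree r"
  obtain m where m: "?k = Suc m" using assms by (cases ?k) auto
  have "(\<Sum>j<?k. qshift (coeff p j) * companion_mat r $$ (j, i))
      = (\<Sum>j<?k. if i = Suc j then qshift (coeff p j) else 0)
        - (\<Sum>j<?k. if j = m then qshift (coeff p j) * (coeff r i / lead_coeff r) else 0)"
    unfolding sum_subtractf[symmetric]
    by (intro sum.cong) (use assms m in \<open>auto simp: companion_mat_def\<close>)
  also have "(\<Sum>j<?k. if i = Suc j then qshift (coeff p j) else 0) = coeff (shift_mult p) i"
    using assms by (cases i) (auto simp: shift_mult_def coeff_map_poly)
  also have "(\<Sum>j<?k. if j = m then qshift (coeff p j) * (coeff r i / lead_coeff r) else 0)
      = coeff (shift_mult p) ?k / lead_coeff r * coeff r i"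
    by (simp add: m shift_mult_def coeff_map_poly)
  finally show ?thesis
    by (simp add: companion_L_def lower_def)
qed


section \<open>The determinant of a tuple of residues\<close>

definition coeff_mat :: "nat \<Rightarrow> 'a::zero poly list \<Rightarrow> 'a mat" where
  "coeff_mat k ps = mat k k (\<lambda>(i, j). coeff (ps ! i) j)"

lemma coeff_mat_carrier [simp]: "coeff_mat k ps \<in> carrier_mat k k"
  by (simp add: coeff_mat_def)

lemma cofactor_coeff_mat_update:
  assumes "i < k" "j < k"
  shows "cofactor (coeff_mat k (ps[i := p])) i j = cofactor (coeff_mat k ps) i j"
proof -
  have "mat_delete (coeff_mat k (ps[i := p])) i j = mat_delete (coeff_mat k ps) i j"
    by (rule eq_matI) (auto simp: mat_delete_def coeff_mat_def)
  then show ?thesis by (simp add: cofactor_def)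
qed

text \<open>Laplace expansion along row \<open>i\<close>, whose cofactors ignore that row, exhibits
  linearity in \<open>p\<close>.\<close>

lemma det_coeff_mat_update:
  fixes p :: "'a::comm_ring_1 poly"
  assumes "i < k" "length ps = k"
  shows "det (coeff_mat k (ps[i := p])) = (\<Sum>j<k. coeff p j * cofactor (coeff_mat k ps) i j)"
  by (subst laplace_expansion_row[OF coeff_mat_carrier assms(1)], rule sum.cong)
    (use assms in \<open>simp_all add: cofactor_coeff_mat_update\<close>, simp add: coeff_mat_def)

lemma det_coeff_mat_identical:
  fixes ps :: "'a::comm_ring_1 poly list"
  assumes "i < j" "j < k" "ps ! i = ps ! j"
  shows "det (coeff_mat k ps) = 0"
  by (rule det_identical_rows[OF coeff_mat_carrier, of i j])
    (use assms in \<open>auto simp: coeff_mat_def\<close>)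

lemma comm_ring_hom_qshift: "comm_ring_hom (qshift :: 'k::field_char_0 ratfun \<Rightarrow> _)"
  by standard (simp_all add: qshift_add qshift_mult)

text \<open>On row vectors, \<open>companion_L\<close> is the entrywise q-shift followed by right
  multiplication by the companion matrix, and the q-shift, a ring homomorphism, commutes with
  \<open>det\<close>.\<close>

lemma det_coeff_mat_companion_L:
  assumes "length ps = degree r"
  shows "det (coeff_mat (degree r) (map (companion_L r) ps))
    = det (companion_mat r) * qshift (det (coeff_mat (degree r) ps))"
proof -
  let ?k = "degree r"
  have "coeff_mat ?k (map (companion_L r) ps) = map_mat qshift (coeff_mat ?k ps) * companion_mat r"
    by (rule eq_matI)
      (use assms in \<open>auto simp: coeff_mat_def coeff_companion_L scalar_prod_def
        companion_mat_def atLeast0LessThan intro!: sum.cong\<close>)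
  moreover have "companion_mat r \<in> carrier_mat ?k ?k"
    by (simp add: companion_mat_def)
  moreover have "det (map_mat qshift (coeff_mat ?k ps)) = qshift (det (coeff_mat ?k ps))"
    by (rule comm_ring_hom.hom_det[OF comm_ring_hom_qshift])
  ultimately show ?thesis
    by (simp add: det_mult[of _ ?k])
qed

section \<open>Linear functionals on free vector spaces\<close>

definition free_extend :: "('b \<Rightarrow> 'r::field) \<Rightarrow> ('b \<Rightarrow>\<^sub>0 'r) \<Rightarrow> 'r" where
  "free_extend g x = (\<Sum>b\<in>Poly_Mapping.keys x. Poly_Mapping.lookup x b * g b)"

lemma free_extend_superset:
  assumes "finite A" "Poly_Mapping.keys x \<subseteq> A"
  shows "free_extend g x = (\<Sum>b\<in>A. Poly_Mapping.lookup x b * g b)"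
  unfolding free_extend_def
  by (rule sum.mono_neutral_left) (use assms in \<open>auto simp: in_keys_iff\<close>)

lemma free_extend_add: "free_extend g (x + y) = free_extend g x + free_extend g y"
  using keys_add[of x y]
  by (simp add: free_extend_superset[of "Poly_Mapping.keys x \<union> Poly_Mapping.keys y"]
      lookup_add algebra_simps sum.distrib)

lemma free_extend_scale: "free_extend g (pm_scale c x) = c * free_extend g x"
proof -
  have "Poly_Mapping.keys (pm_scale c x) \<subseteq> Poly_Mapping.keys x"
    by (auto simp: in_keys_iff)
  then show ?thesis
    by (simp add: free_extend_superset[of "Poly_Mapping.keys x"] sum_distrib_left mult.assoc)
qed

lemma free_extend_diff: "free_extend g (x - y) = free_extend g x - free_extend g y"
  using free_extend_add[of g "x - y" y] by simp

lemma free_extend_single [simp]: "free_extend g (Poly_Mapping.single b c) = c * g b"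
  by (simp add: free_extend_superset[of "{b}"])

section \<open>The volume form on the exterior power\<close>

locale right_factor =
  fixes P Q R :: "'k::field_char_0 qweyl"
  assumes factor: "P = Q * R"
begin

abbreviation r where "r \<equiv> poly_of_qweyl R"

text \<open>The projection of \<open>W / W P\<close> onto \<open>W / W R\<close> in coordinates;
  \<open>coset_residue_coset\<close> shows that the representative does not matter.\<close>

definition coset_residue :: "'k qweyl set \<Rightarrow> 'k ratfun poly" where
  "coset_residue X = residue r (poly_of_qweyl (SOME A. X = A +o left_ideal P))"

definition volume :: "'k qweyl set list \<Rightarrow> 'k ratfun" where
  "volume vs = det (coeff_mat (deg_L R) (map coset_residue vs))"

text \<open>The factorization enters here: \<open>S P = (S Q) R\<close>, and \<open>R\<close> kills
  the class of 1.\<close>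

lemma residue_left_ideal:
  assumes "A \<in> left_ideal P"
  shows "residue r (poly_of_qweyl A) = 0"
proof -
  from assms obtain S where "A = (S * Q) * R"
    by (auto simp: left_ideal_def factor mult.assoc)
  moreover have "ore_act Polynomial.smult (companion_L r) p 0 = 0" for p
    using companion.ore_act_add_right[of r p 0 0]
    by (simp only: add_0_right add_cancel_right_right)
  ultimately show ?thesis
    by (simp add: times_qweyl.rep_eq[of "S * Q"] residue_times residue_self)
qed

lemma coset_residue_coset: "coset_residue (A +o left_ideal P) = residue r (poly_of_qweyl A)"
proof -
  define B where "B = (SOME B. A +o left_ideal P = B +o left_ideal P)"
  have "A +o left_ideal P = B +o left_ideal P"
    unfolding B_def by (rule someI) (rule refl)
  then have "residue r (poly_of_qweyl (A - B)) = 0"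
    by (intro residue_left_ideal) (simp add: quot_coset_eq_iff)
  moreover have "poly_of_qweyl A = poly_of_qweyl (A - B) + poly_of_qweyl B"
    by (simp add: minus_qweyl.rep_eq)
  ultimately have "residue r (poly_of_qweyl A) = residue r (poly_of_qweyl B)"
    by (simp add: residue_add del: diff_add_cancel)
  then show ?thesis by (simp add: coset_residue_def B_def)
qed

lemma coset_residue_add:
  "X \<in> quot_carrier P \<Longrightarrow> Y \<in> quot_carrier P \<Longrightarrow>
    coset_residue (X + Y) = coset_residue X + coset_residue Y"
  by (elim quot_carrierE)
    (simp add: quot_add_coset coset_residue_coset plus_qweyl.rep_eq residue_add)

lemma coset_residue_scale:
  "X \<in> quot_carrier P \<Longrightarrow>
    coset_residue (quot_act P (of_ratfun c) X) = Polynomial.smult c (coset_residue X)"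
  by (elim quot_carrierE)
    (simp add: quot_act_coset coset_residue_coset poly_of_ratfun_times residue_smult)

lemma coset_residue_opL:
  "X \<in> quot_carrier P \<Longrightarrow> coset_residue (quot_act P opL X) = companion_L r (coset_residue X)"
  by (elim quot_carrierE)
    (simp add: quot_act_coset coset_residue_coset poly_of_opL_times residue_shift_mult)

text \<open>Row expansion handles the relators of multilinearity, equal rows the alternating ones;
  hence \<open>volume\<close> descends to the exterior power.\<close>

lemma volume_relators:
  assumes "x \<in> wedge_relators (quot_carrier P) (+) (\<lambda>c. quot_act P (of_ratfun c)) (deg_L R)"
  shows "free_extend volume x = 0"
  using assms unfolding wedge_relators_def tuples_def
  by (auto simp: free_extend_diff free_extend_scale volume_def map_update det_coeff_mat_update
      coset_residue_add coset_residue_scale distrib_right sum.distrib sum_distrib_left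
      mult.assoc intro!: det_coeff_mat_identical)

lemma volume_ext_null:
  assumes "x \<in> ext_null P (deg_L R)"
  shows "free_extend volume x = 0"
  using assms unfolding ext_null_def
  by (induction rule: pm.span_induct_alt)
    (simp_all add: free_extend_add free_extend_scale volume_relators, simp add: free_extend_def)

lemma volume_opL:
  assumes "vs \<in> tuples (quot_carrier P) (deg_L R)"
  shows "volume (map (quot_act P opL) vs) = det (companion_mat r) * qshift (volume vs)"
proof -
  have "map coset_residue (map (quot_act P opL) vs) = map (companion_L r) (map coset_residue vs)"
    using assms by (auto simp: tuples_def coset_residue_opL)
  then show ?thesis
    using assms det_coeff_mat_companion_L[of "map coset_residue vs" r]
    by (simp add: volume_def tuples_def deg_L.rep_eq del: map_map)
qed

text \<open>Each induction step moves one \<open>L\<close> onto the tuple and its scalar, so both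
  must vary.\<close>

lemma volume_ore_act:
  assumes "vs \<in> tuples (quot_carrier P) (deg_L R)"
  shows "free_extend volume (ore_act pm_scale (free_L P) p (Poly_Mapping.single vs c))
    = ore_act (*) (\<lambda>y. det (companion_mat r) * qshift y) p (c * volume vs)"
  using assms
proof (induction p arbitrary: vs c)
  case 0
  show ?case by (simp add: free.ore_act_0 rank_one.ore_act_0 free_extend_def)
next
  case (pCons b p)
  then show ?case
    by (simp add: free.ore_act_pCons rank_one.ore_act_pCons free_extend_add free_L_single
        map_tuples volume_opL qshift_mult mult.left_commute)
qed

text \<open>The powers of \<open>L\<close> below the degree of \<open>R\<close> are already reduced,
  so their coordinates form the identity matrix.\<close>

lemma volume_generator:
  "volume (map (\<lambda>i. quot_act P (opL ^ i) (quot_gen P)) [0..<deg_L R]) = 1"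
proof -
  have "coeff_mat (deg_L R) (map coset_residue
      (map (\<lambda>i. quot_act P (opL ^ i) (quot_gen P)) [0..<deg_L R])) = 1\<^sub>m (deg_L R)"
    by (rule eq_matI)
      (auto simp: coeff_mat_def quot_gen_def quot_act_coset coset_residue_coset deg_L.rep_eq
        poly_of_opL_power residue_monom)
  then show ?thesis by (simp add: volume_def)
qed

lemma ext_ann_linear_factor:
  assumes "S \<in> ext_ann P (deg_L R)"
  shows "S \<in> left_ideal (opL - of_ratfun (det (companion_mat r)))"
proof -
  let ?a = "det (companion_mat r)"
  let ?vs = "map (\<lambda>i. quot_act P (opL ^ i) (quot_gen P)) [0..<deg_L R]"
  have "?vs \<in> tuples (quot_carrier P) (deg_L R)"
    by (auto simp: tuples_def quot_gen_def intro!: quot_act_closed)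
  \<comment> \<open>The argument 1 is the volume of the generator: \<open>S\<close> annihilates
    \<open>w\<close>.\<close>
  then have "ore_act (*) (\<lambda>y. ?a * qshift y) (poly_of_qweyl S) 1 = 0"
    using volume_ext_null[of "free_act P S (Poly_Mapping.single ?vs 1)"] assms
      volume_ore_act[of ?vs "poly_of_qweyl S" 1]
    by (simp add: ext_ann_iff free_act_def volume_generator del: map_map)
  then show ?thesis
    using rank_one_remainder[of "poly_of_qweyl S" 1 ?a] by (simp add: poly_of_qweyl_inverse)
qed

end

theorem theorem4p8:
  fixes P Q R E :: "'k::field_char_0 qweyl" and k :: nat
  assumes "P \<noteq> 0"
    and "P = Q * R"
    and "k = deg_L R"
    and "is_exterior_power k P E"
  shows "\<exists>a :: 'k ratfun. E \<in> left_ideal (opL - of_ratfun a)"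
proof -
  interpret right_factor P Q R
    by standard (fact assms(2))
  have "E \<in> left_ideal E"
    by (auto simp: left_ideal_def intro: exI[of _ 1])
  then have "E \<in> ext_ann P (deg_L R)"
    using assms(3,4) by (simp add: is_exterior_power_def)
  then show ?thesis
    by (blast dest: ext_ann_linear_factor)
qed

end
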